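(* For all $a,N,M\in\mathbb{N}$ with $N\le M$, $$\frac{(-q^{2a};q^{2a})_{N+M-1}}{(-q^a;q^{2a})_N\,(q^a;q^{2a})_M}\in\mathbb{N}_0[[q]].$$
   Context: $\mathbb{N}$ is the set of positive integers and $\mathbb{N}_0=\mathbb{N}\cup\{0\}$. Notation: $(z;q)_n=\prod_{i=0}^{n-1}(1-zq^i)$. The quotient is expanded as a formal power series in $q$; $\mathbb{N}_0[[q]]$ is the set of power series with non-negative integer coefficients. *)

theory Defs
  imports "HOL-Computational_Algebra.Formal_Power_Series"
begin

definition qpochhammer :: "'a::comm_ring_1 \<Rightarrow> 'a \<Rightarrow> nat \<Rightarrow> 'a" where
  "qpochhammer z q n = (\<Prod>i<n. (1 - z * q ^ i))"

(* The set of power series with non-negative integer coefficients, as a subset of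
   the power series over a larger coefficient ring: on fps, the division operator
   is available only over a field-like coefficient type. *)
definition nat_coeff_fps :: "'a::semiring_1 fps set" where
  "nat_coeff_fps = {f. \<forall>n. fps_nth f n \<in> \<nat>}"

end

theory Submission
  imports Defs
begin

text \<open>
  Pairing the factors \<open>1 + q\<^bsup>a(2i+1)\<^esup>\<close> with \<open>1 - q\<^bsup>a(2i+1)\<^esup>\<close> for \<open>i < N\<close>, which is possible
  because \<open>N \<le> M\<close>, turns the denominator into a product of factors of the form \<open>1 - q\<^sup>k\<close> with
  \<open>k > 0\<close>. Their inverses are geometric series, and the numerator is a product of factors
  \<open>1 + q\<^sup>k\<close>.
\<close>

lemma Nats_sum:
  fixes f :: "'b \<Rightarrow> 'a::semiring_1"
  shows "(\<And>i. i \<in> I \<Longrightarrow> f i \<in> \<nat>) \<Longrightarrow> sum f I \<in> \<nat>"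
  by (induction I rule: infinite_finite_induct) auto

lemma fps_prod_nth_0:
  fixes f :: "'b \<Rightarrow> 'a::comm_semiring_1 fps"
  shows "fps_nth (prod f I) 0 = (\<Prod>i\<in>I. fps_nth (f i) 0)"
  by (induction I rule: infinite_finite_induct) auto

lemma nat_coeff_fps_1: "1 \<in> nat_coeff_fps"
  by (simp add: nat_coeff_fps_def)

lemma nat_coeff_fps_X_power: "fps_X ^ k \<in> nat_coeff_fps"
  by (simp add: nat_coeff_fps_def fps_X_power_nth)

lemma nat_coeff_fps_add:
  "f \<in> nat_coeff_fps \<Longrightarrow> g \<in> nat_coeff_fps \<Longrightarrow> f + g \<in> nat_coeff_fps"
  by (simp add: nat_coeff_fps_def Nats_add)

lemma nat_coeff_fps_mult:
  "f \<in> nat_coeff_fps \<Longrightarrow> g \<in> nat_coeff_fps \<Longrightarrow> f * g \<in> nat_coeff_fps"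
  by (auto simp: nat_coeff_fps_def fps_mult_nth intro!: Nats_sum Nats_mult)

lemma nat_coeff_fps_prod:
  fixes f :: "'b \<Rightarrow> 'a::comm_semiring_1 fps"
  shows "(\<And>i. i \<in> I \<Longrightarrow> f i \<in> nat_coeff_fps) \<Longrightarrow> prod f I \<in> nat_coeff_fps"
  by (induction I rule: infinite_finite_induct) (auto intro: nat_coeff_fps_1 nat_coeff_fps_mult)

text \<open>The inverse \<open>g\<close> solves \<open>g = 1 + h * g\<close>. As \<open>h\<close>
  has zero constant term, the \<open>n\<close>-th coefficient of \<open>h * g\<close> involves only
  earlier coefficients of \<open>g\<close>, so strong induction applies.\<close>

lemma nat_coeff_fps_inverse_one_minus:
  fixes h :: "'a::field fps"
  assumes h: "h \<in> nat_coeff_fps" and h0: "fps_nth h 0 = 0"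
  shows "inverse (1 - h) \<in> nat_coeff_fps"
proof -
  define g where "g = inverse (1 - h)"
  have "g * (1 - h) = 1"
    unfolding g_def by (rule inverse_mult_eq_1) (simp add: h0)
  then have g: "g = 1 + h * g"
    by (simp add: algebra_simps)
  have "fps_nth g n \<in> \<nat>" for n
  proof (induction n rule: less_induct)
    case (less n)
    have "fps_nth h i * fps_nth g (n - i) \<in> \<nat>" if "i \<le> n" for i
    proof (cases "i = 0")
      case False
      with that have "n - i < n" by simp
      with less.IH h show ?thesis
        by (auto simp: nat_coeff_fps_def intro: Nats_mult)
    qed (simp add: h0)
    then have "fps_nth (1 + h * g) n \<in> \<nat>"
      by (auto simp: fps_mult_nth intro!: Nats_add Nats_sum)
    with g show ?case by simp
  qed
  then show ?thesis
    by (simp add: g_def nat_coeff_fps_def)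
qed

theorem theorem3p2:
  fixes a N M :: nat
  assumes "a \<ge> 1" and "N \<ge> 1" and "M \<ge> 1" and "N \<le> M"
  shows "qpochhammer (- (fps_X ^ (2 * a))) (fps_X ^ (2 * a)) (N + M - 1)
           / (qpochhammer (- (fps_X ^ a)) (fps_X ^ (2 * a)) N
              * qpochhammer (fps_X ^ a) (fps_X ^ (2 * a)) M)
         \<in> (nat_coeff_fps :: rat fps set)"
proof -
  \<comment> \<open>Both denominator products are built from the same terms \<open>y i\<close>, with
    factors \<open>1 + y i\<close> and \<open>1 - y i\<close>.\<close>
  define y :: "nat \<Rightarrow> rat fps" where "y i = fps_X ^ (a + 2 * a * i)" for i
  define P where
    "P = qpochhammer (- (fps_X ^ (2 * a))) (fps_X ^ (2 * a) :: rat fps) (N + M - 1)"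
  define D where "D = (\<Prod>i<N. 1 - (y i)\<^sup>2) * (\<Prod>i\<in>{N..<M}. 1 - y i)"
  have y0: "fps_nth (y i) 0 = 0" for i
    using \<open>a \<ge> 1\<close> by (simp add: y_def)
  have y_nat: "y i \<in> nat_coeff_fps" for i
    by (simp add: y_def nat_coeff_fps_X_power)
  have "(\<Prod>i<N. 1 + y i) * (\<Prod>i<M. 1 - y i)
      = (\<Prod>i<N. 1 + y i) * ((\<Prod>i<N. 1 - y i) * (\<Prod>i\<in>{N..<M}. 1 - y i))"
    using \<open>N \<le> M\<close> by (simp add: lessThan_atLeast0 prod.atLeastLessThan_concat)
  also have "\<dots> = D"
    by (simp add: D_def algebra_simps power2_eq_square flip: prod.distrib)
  finally have denominator:
    "qpochhammer (- (fps_X ^ a)) (fps_X ^ (2 * a)) N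
       * qpochhammer (fps_X ^ a) (fps_X ^ (2 * a)) M = D"
    by (simp add: qpochhammer_def y_def power_add power_mult)
  \<comment> \<open>The two minus signs cancel, leaving factors
    \<open>1 + fps_X ^ k\<close>.\<close>
  have P: "P \<in> nat_coeff_fps"
    by (auto simp: P_def qpochhammer_def simp flip: power_mult power_add
        intro!: nat_coeff_fps_prod nat_coeff_fps_add nat_coeff_fps_1 nat_coeff_fps_X_power)
  \<comment> \<open>Inversion distributes over the products, so each factor is handled with
    \<open>h = (y i)\<^sup>2\<close> or \<open>h = y i\<close>.\<close>
  have inverse_D: "inverse D \<in> nat_coeff_fps"
    unfolding D_def fps_inverse_mult inverse_prod_fps
    by (intro nat_coeff_fps_mult nat_coeff_fps_prod nat_coeff_fps_inverse_one_minus)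
      (auto simp: y0 power2_eq_square intro: y_nat nat_coeff_fps_mult)
  \<comment> \<open>The constant term of \<open>D\<close> is 1, so \<open>D\<close> is a unit and
    the quotient is multiplication by \<open>inverse D\<close>.\<close>
  have "fps_nth D 0 \<noteq> 0"
    by (simp add: D_def fps_prod_nth_0 y0 fps_mult_nth_0 power2_eq_square)
  then have "P / D = P * inverse D"
    by (rule fps_divide_unit)
  with P inverse_D show ?thesis
    unfolding denominator P_def[symmetric] by (simp add: nat_coeff_fps_mult)
qed

end
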